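(* Let $n_1,n_2\ge 2$ be integers, let $u_1,v_1\in C^{n_1}([a,b])$, $u_2,v_2\in C^{n_2}([c,d])$ be such that $\mathcal P^{n_1}_{u_1,v_1}([a,b])$ and $\mathcal P^{n_2}_{u_2,v_2}([c,d])$ have dimension $n_1$ and $n_2$ respectively and both satisfy conditions (C1) and (C2) of the context. Then for every $f\in C^{\mathbf n}([a,b]\times[c,d])$, $\mathbf n=(n_1,n_2)$, and every $(s_0,t_0)\in(a,b)\times(c,d)$ there exists a unique function $Q_L(f;s_0,t_0)\in\mathcal P^{\mathbf n}_{\mathbf u,\mathbf v}([a,b]\times[c,d])$ whose polynomial (Taylor) expansion at $(s_0,t_0)$ of coordinate bi-degree $(n_1-1,n_2-1)$ coincides with that of $f$, i.e. $$D_s^iD_t^jQ_L(f;s_0,t_0)(s_0,t_0)=D_s^iD_t^jf(s_0,t_0),\qquad 0\le i\le n_1-1,\ 0\le j\le n_2-1.$$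
   Context: For $n\ge 3$ and $u,v\in C^n([a,b])$, $\mathcal P^n_{u,v}([a,b])=\mathrm{span}\langle 1,s,\dots,s^{n-3},u(s),v(s)\rangle$ (functions on $[a,b]$); $\mathcal P^2_{u,v}([a,b])=\mathrm{span}\langle u,v\rangle$. Conditions on $\mathcal P^n_{u,v}([a,b])$: (C1) for all $\psi\in\mathcal P^n_{u,v}([a,b])$, if $\psi^{(n-2)}(s_1)=\psi^{(n-2)}(s_2)=0$ for some $s_1\ne s_2$ in $[a,b]$, then $\psi^{(n-2)}\equiv 0$ on $[a,b]$; (C2) for all $\psi\in\mathcal P^n_{u,v}([a,b])$, if $\psi^{(n-2)}(s_1)=\psi^{(n-1)}(s_1)=0$ for some $s_1\in(a,b)$, then $\psi^{(n-2)}\equiv 0$ on $[a,b]$. $\mathcal P^{\mathbf n}_{\mathbf u,\mathbf v}([a,b]\times[c,d])=\mathrm{span}\langle g_1(s)g_2(t): g_1\in\mathcal P^{n_1}_{u_1,v_1}([a,b]),\ g_2\in\mathcal P^{n_2}_{u_2,v_2}([c,d])\rangle$. $C^{\mathbf n}$ denotes the functions $f(s,t)$ whose derivatives $D_s^iD_t^jf$ are continuous for $0\le i\le n_1$, $0\le j\le n_2$. *)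

theory Defs
  imports "HOL-Analysis.Analysis" "HOL-Library.Function_Algebras"
begin

text \<open>The pointwise real vector space of functions \<open>'a \<Rightarrow> real\<close>; the library has no
  \<open>real_vector\<close> instance for function types.\<close>

global_interpretation fun_space: vector_space "\<lambda>(r::real) (f::'a \<Rightarrow> real) x. r * f x"
  by unfold_locales (auto simp: fun_eq_iff algebra_simps)

text \<open>A function on a set \<open>S\<close> is represented by its extension by zero. Thus equality, span and
  dimension in \<open>fun_space\<close> are those of functions on \<open>S\<close>.\<close>

definition on_set :: "'a set \<Rightarrow> ('a \<Rightarrow> real) \<Rightarrow> 'a \<Rightarrow> real" where
  "on_set S f = (\<lambda>x. if x \<in> S then f x else 0)"

text \<open>The derivatives are taken within \<open>S\<close> (one-sided at the end points of an interval), so at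
  points of \<open>S\<close> they depend only on the values of \<open>f\<close> on \<open>S\<close>. If a derivative does not exist,
  its value is arbitrary; existence is required in \<open>Cn_on\<close> and \<open>Cn2_on\<close>.\<close>

definition nth_deriv :: "real set \<Rightarrow> nat \<Rightarrow> (real \<Rightarrow> real) \<Rightarrow> real \<Rightarrow> real" where
  "nth_deriv S k f = ((\<lambda>g x. vector_derivative g (at x within S)) ^^ k) f"

definition Cn_on :: "nat \<Rightarrow> real set \<Rightarrow> (real \<Rightarrow> real) \<Rightarrow> bool" where
  "Cn_on n S f \<longleftrightarrow>
     (\<forall>k<n. \<forall>x\<in>S. nth_deriv S k f differentiable (at x within S)) \<and>
     (\<forall>k\<le>n. continuous_on S (nth_deriv S k f))"

text \<open>\<open>mixed_deriv S T i j f\<close> is \<open>D\<^sub>s\<^sup>i D\<^sub>t\<^sup>j f\<close> on \<open>S \<times> T\<close>, with the \<open>t\<close>-derivatives taken first.\<close>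

definition mixed_deriv ::
  "real set \<Rightarrow> real set \<Rightarrow> nat \<Rightarrow> nat \<Rightarrow> (real \<times> real \<Rightarrow> real) \<Rightarrow> real \<times> real \<Rightarrow> real" where
  "mixed_deriv S T i j f = (\<lambda>(s, t). nth_deriv S i (\<lambda>\<sigma>. nth_deriv T j (\<lambda>\<tau>. f (\<sigma>, \<tau>)) t) s)"

definition Cn2_on ::
  "nat \<Rightarrow> nat \<Rightarrow> real set \<Rightarrow> real set \<Rightarrow> (real \<times> real \<Rightarrow> real) \<Rightarrow> bool" where
  "Cn2_on n1 n2 S T f \<longleftrightarrow>
     (\<forall>j<n2. \<forall>s\<in>S. \<forall>t\<in>T.
        (\<lambda>\<tau>. mixed_deriv S T 0 j f (s, \<tau>)) differentiable (at t within T)) \<and>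
     (\<forall>i<n1. \<forall>j\<le>n2. \<forall>s\<in>S. \<forall>t\<in>T.
        (\<lambda>\<sigma>. mixed_deriv S T i j f (\<sigma>, t)) differentiable (at s within S)) \<and>
     (\<forall>i\<le>n1. \<forall>j\<le>n2. continuous_on (S \<times> T) (mixed_deriv S T i j f))"

text \<open>For \<open>n \<ge> 3\<close> the monomials are \<open>1, \<dots>, s\<^sup>n\<^sup>-\<^sup>3\<close>; for \<open>n = 2\<close> there are none.\<close>

definition Pspace ::
  "nat \<Rightarrow> (real \<Rightarrow> real) \<Rightarrow> (real \<Rightarrow> real) \<Rightarrow> real set \<Rightarrow> (real \<Rightarrow> real) set" where
  "Pspace n u v S =
     fun_space.span ({on_set S (\<lambda>s. s ^ i) | i. i < n - 2} \<union> {on_set S u, on_set S v})"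

definition C1 :: "nat \<Rightarrow> (real \<Rightarrow> real) \<Rightarrow> (real \<Rightarrow> real) \<Rightarrow> real \<Rightarrow> real \<Rightarrow> bool" where
  "C1 n u v a b \<longleftrightarrow>
     (\<forall>\<psi>\<in>Pspace n u v {a..b}.
        (\<exists>s1\<in>{a..b}. \<exists>s2\<in>{a..b}. s1 \<noteq> s2 \<and>
           nth_deriv {a..b} (n - 2) \<psi> s1 = 0 \<and> nth_deriv {a..b} (n - 2) \<psi> s2 = 0) \<longrightarrow>
        (\<forall>s\<in>{a..b}. nth_deriv {a..b} (n - 2) \<psi> s = 0))"

definition C2 :: "nat \<Rightarrow> (real \<Rightarrow> real) \<Rightarrow> (real \<Rightarrow> real) \<Rightarrow> real \<Rightarrow> real \<Rightarrow> bool" where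
  "C2 n u v a b \<longleftrightarrow>
     (\<forall>\<psi>\<in>Pspace n u v {a..b}.
        (\<exists>s1\<in>{a<..<b}.
           nth_deriv {a..b} (n - 2) \<psi> s1 = 0 \<and> nth_deriv {a..b} (n - 1) \<psi> s1 = 0) \<longrightarrow>
        (\<forall>s\<in>{a..b}. nth_deriv {a..b} (n - 2) \<psi> s = 0))"

definition tensor_span ::
  "(real \<Rightarrow> real) set \<Rightarrow> (real \<Rightarrow> real) set \<Rightarrow> (real \<times> real \<Rightarrow> real) set" where
  "tensor_span P1 P2 =
     fun_space.span {(\<lambda>(s, t). g1 s * g2 t) | g1 g2. g1 \<in> P1 \<and> g2 \<in> P2}"

end

theory Submission
  imports Defs "HOL-Computational_Algebra.Polynomial"
begin

text \<open>
  The theorem is the two-dimensional form of a one-dimensional fact about Taylor coefficients.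
  For \<open>P = Pspace n u v {a..b}\<close> and \<open>s\<^sub>0\<close> in the open interval, the map sending \<open>\<psi>\<close> to
  \<open>(\<psi> s\<^sub>0, \<psi>' s\<^sub>0, \<dots>)\<close>, with \<open>n\<close> entries, is injective on \<open>P\<close>: if all entries vanish, the last two
  and \<open>C2\<close> force the derivative of order \<open>n - 2\<close> to vanish identically, and integrating back
  from \<open>s\<^sub>0\<close>, where all lower derivatives vanish too, gives \<open>\<psi> = 0\<close> (\<open>Taylor_determines\<close>).
  As \<open>dim P = n\<close>, the map is bijective, so \<open>P\<close> has a basis \<open>p\<^sub>0, \<dots>\<close> dual to the Taylor
  functionals at \<open>s\<^sub>0\<close> (\<open>dual_basis\<close>, \<open>Taylor_basis\<close>).

  With the dual bases \<open>p\<close>, \<open>q\<close> of the two factors, each element of the tensor product is a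
  combination \<open>\<Sum> c\<^sub>i\<^sub>j p\<^sub>i(s) q\<^sub>j(t)\<close> (\<open>tensor_span_expand\<close>), and by duality its mixed derivative
  of order \<open>(i, j)\<close> at \<open>(s\<^sub>0, t\<^sub>0)\<close> is exactly \<open>c\<^sub>i\<^sub>j\<close> (\<open>mixed_deriv_expand\<close>). Hence the
  interpolation conditions prescribe the coefficients \<open>c\<^sub>i\<^sub>j\<close>, freely and completely.
\<close>

section \<open>Iterated derivatives on a compact interval\<close>

lemma nth_deriv_0 [simp]: "nth_deriv S 0 f = f"
  by (simp add: nth_deriv_def)

lemma nth_deriv_Suc:
  "nth_deriv S (Suc k) f x = vector_derivative (nth_deriv S k f) (at x within S)"
  by (simp add: nth_deriv_def)

text \<open>Continuity of the top derivative is left out of this notion, so that membership in it only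
  requires exhibiting a chain of derivatives.\<close>

definition n_times_diff :: "nat \<Rightarrow> real set \<Rightarrow> (real \<Rightarrow> real) \<Rightarrow> bool" where
  "n_times_diff n S f \<longleftrightarrow> (\<forall>k<n. \<forall>x\<in>S.
     (nth_deriv S k f has_vector_derivative nth_deriv S (Suc k) f x) (at x within S))"

lemma Cn_on_imp_n_times_diff: "Cn_on n S f \<Longrightarrow> n_times_diff n S f"
  by (simp add: Cn_on_def n_times_diff_def nth_deriv_Suc flip: vector_derivative_works)

text \<open>Derivatives within \<open>{a..b}\<close> are unique because no point of a nondegenerate interval is
  isolated. The chain \<open>D\<close> need only be specified on \<open>{a..b}\<close>; this absorbs the
  extensions by zero and the arbitrary values of \<open>nth_deriv\<close> elsewhere.\<close>

lemma nth_deriv_eq_chain: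
  assumes "a < b" "\<And>x. x \<in> {a..b} \<Longrightarrow> f x = D 0 x"
    and D: "\<And>k x. k < n \<Longrightarrow> x \<in> {a..b} \<Longrightarrow>
      (D k has_vector_derivative D (Suc k) x) (at x within {a..b})"
    and "k \<le> n" "x \<in> {a..b}"
  shows "nth_deriv {a..b} k f x = D k x"
  using assms(4,5)
proof (induction k arbitrary: x)
  case 0
  then show ?case using assms(2) by simp
next
  case (Suc k)
  have "(nth_deriv {a..b} k f has_vector_derivative D (Suc k) x) (at x within {a..b})"
    by (rule has_vector_derivative_transform[OF _ _ D]) (use Suc in auto)
  then show ?case
    using vector_derivative_within_cbox[of a b x "nth_deriv {a..b} k f" "D (Suc k) x"]
      \<open>a < b\<close> Suc.prems by (simp add: nth_deriv_Suc)
qed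

lemma n_times_diff_chain:
  assumes "a < b" "\<And>x. x \<in> {a..b} \<Longrightarrow> f x = D 0 x"
    and D: "\<And>k x. k < n \<Longrightarrow> x \<in> {a..b} \<Longrightarrow>
      (D k has_vector_derivative D (Suc k) x) (at x within {a..b})"
  shows "n_times_diff n {a..b} f"
  unfolding n_times_diff_def
proof (intro allI impI ballI)
  fix k x assume k: "k < n" and x: "x \<in> {a..b}"
  have eq: "nth_deriv {a..b} i f y = D i y" if "i \<le> n" "y \<in> {a..b}" for i y
    using nth_deriv_eq_chain[of a b f D n i y] assms that by blast
  show "(nth_deriv {a..b} k f has_vector_derivative nth_deriv {a..b} (Suc k) f x)
      (at x within {a..b})"
    by (rule has_vector_derivative_transform[of x "{a..b}" _ "D k"])
       (use k x D eq in auto)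
qed

lemma n_times_diff_on_set:
  assumes "a < b" "n_times_diff n {a..b} f"
  shows "n_times_diff n {a..b} (on_set {a..b} f)"
  by (rule n_times_diff_chain[where D = "\<lambda>k. nth_deriv {a..b} k f"])
     (use assms in \<open>auto simp: n_times_diff_def on_set_def\<close>)

lemma n_times_diff_power:
  assumes "a < b"
  shows "n_times_diff n {a..b} (\<lambda>s. s ^ i)"
proof (rule n_times_diff_chain[where D = "\<lambda>k. poly ((pderiv ^^ k) (monom 1 i))"])
  fix k x
  show "(poly ((pderiv ^^ k) (monom 1 i)) has_vector_derivative
      poly ((pderiv ^^ Suc k) (monom 1 i)) x) (at x within {a..b})"
    using poly_DERIV[of "(pderiv ^^ k) (monom 1 i)" x]
    by (simp add: has_real_derivative_iff_has_vector_derivative has_vector_derivative_at_within)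
qed (use assms in \<open>auto simp: poly_monom\<close>)

lemma
  assumes "a < b" "n_times_diff n {a..b} f" "n_times_diff n {a..b} g"
  shows n_times_diff_lincomb: "n_times_diff n {a..b} (\<lambda>x. r * f x + g x)"
    and nth_deriv_lincomb: "\<And>k x. k \<le> n \<Longrightarrow> x \<in> {a..b} \<Longrightarrow>
      nth_deriv {a..b} k (\<lambda>x. r * f x + g x) x =
      r * nth_deriv {a..b} k f x + nth_deriv {a..b} k g x"
proof -
  let ?D = "\<lambda>k x. r * nth_deriv {a..b} k f x + nth_deriv {a..b} k g x"
  have D: "(?D k has_vector_derivative ?D (Suc k) x) (at x within {a..b})"
    if "k < n" "x \<in> {a..b}" for k x
    using assms(2,3) that unfolding n_times_diff_def
    by (intro has_vector_derivative_add has_vector_derivative_mult_right) auto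
  show "n_times_diff n {a..b} (\<lambda>x. r * f x + g x)"
    by (rule n_times_diff_chain[where D = ?D]) (use \<open>a < b\<close> D in auto)
  show "nth_deriv {a..b} k (\<lambda>x. r * f x + g x) x = ?D k x"
    if "k \<le> n" "x \<in> {a..b}" for k x
    by (rule nth_deriv_eq_chain[where D = ?D and n = n]) (use \<open>a < b\<close> D that in auto)
qed

lemma n_times_diff_zero: "a < b \<Longrightarrow> n_times_diff n {a..b} (\<lambda>x. 0)"
  by (rule n_times_diff_chain[where D = "\<lambda>k x. 0"]) auto

lemma nth_deriv_zero: "a < b \<Longrightarrow> x \<in> {a..b} \<Longrightarrow> nth_deriv {a..b} k (\<lambda>x. 0) x = 0"
  by (rule nth_deriv_eq_chain[where D = "\<lambda>k x. 0" and n = k]) auto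

lemma
  fixes p :: "'i \<Rightarrow> real \<Rightarrow> real"
  assumes "a < b" "finite I" "\<And>i. i \<in> I \<Longrightarrow> n_times_diff n {a..b} (p i)"
  shows n_times_diff_sum: "n_times_diff n {a..b} (\<lambda>x. \<Sum>i\<in>I. c i * p i x)"
    and nth_deriv_sum: "\<And>k x. k \<le> n \<Longrightarrow> x \<in> {a..b} \<Longrightarrow>
      nth_deriv {a..b} k (\<lambda>x. \<Sum>i\<in>I. c i * p i x) x = (\<Sum>i\<in>I. c i * nth_deriv {a..b} k (p i) x)"
proof -
  have "n_times_diff n {a..b} (\<lambda>x. \<Sum>i\<in>I. c i * p i x) \<and>
    (\<forall>k\<le>n. \<forall>x\<in>{a..b}.
      nth_deriv {a..b} k (\<lambda>x. \<Sum>i\<in>I. c i * p i x) x = (\<Sum>i\<in>I. c i * nth_deriv {a..b} k (p i) x))"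
    using assms(2,3)
  proof (induction I rule: finite_induct)
    case empty
    then show ?case using \<open>a < b\<close> by (simp add: n_times_diff_zero nth_deriv_zero)
  next
    case (insert j I)
    then show ?case
      using n_times_diff_lincomb[OF \<open>a < b\<close>, of n "p j" "\<lambda>x. \<Sum>i\<in>I. c i * p i x" "c j"]
        nth_deriv_lincomb[OF \<open>a < b\<close>, of n "p j" "\<lambda>x. \<Sum>i\<in>I. c i * p i x" _ _ "c j"]
      by simp
  qed
  then show "n_times_diff n {a..b} (\<lambda>x. \<Sum>i\<in>I. c i * p i x)"
    and "\<And>k x. k \<le> n \<Longrightarrow> x \<in> {a..b} \<Longrightarrow>
      nth_deriv {a..b} k (\<lambda>x. \<Sum>i\<in>I. c i * p i x) x = (\<Sum>i\<in>I. c i * nth_deriv {a..b} k (p i) x)"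
    by auto
qed

text \<open>Repeated integration: descending from order \<open>m\<close>, each derivative has zero derivative on the
  interval, hence is constant, and the constant is its value at \<open>s0\<close>.\<close>

lemma vanish_of_deriv_vanish:
  assumes f: "n_times_diff m {a..b} f" and s0: "s0 \<in> {a..b}"
    and init: "\<And>k. k < m \<Longrightarrow> nth_deriv {a..b} k f s0 = 0"
    and top: "\<And>s. s \<in> {a..b} \<Longrightarrow> nth_deriv {a..b} m f s = 0"
    and "s \<in> {a..b}"
  shows "f s = 0"
proof -
  have "\<forall>s\<in>{a..b}. nth_deriv {a..b} k f s = 0" if "k \<le> m" for k
    using that
  proof (induction k rule: inc_induct)
    case base
    then show ?case using top by blast
  next
    case (step k)
    show ?case
    proof
      fix s assume s: "s \<in> {a..b}"
      have "(nth_deriv {a..b} k f has_vector_derivative 0) (at x within {a..b})"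
        if "x \<in> {a..b}" for x
        using f step that unfolding n_times_diff_def by metis
      then obtain C where "\<And>x. x \<in> {a..b} \<Longrightarrow> nth_deriv {a..b} k f x = C"
        using has_vector_derivative_zero_constant[of "{a..b}" "nth_deriv {a..b} k f"] by auto
      then show "nth_deriv {a..b} k f s = 0"
        using init[of k] step s s0 by metis
    qed
  qed
  from this[of 0] show ?thesis using \<open>s \<in> {a..b}\<close> by simp
qed

section \<open>Bases dual to a determining family of functionals\<close>

lemma sum_fun_apply: "(\<Sum>i\<in>I. g i) x = (\<Sum>i\<in>I. g i x)"
  for g :: "'i \<Rightarrow> 'a \<Rightarrow> real"
  by (induction I rule: infinite_finite_induct) auto

lemma subspace_lincomb_closed:
  assumes "fun_space.subspace P" "finite I" "\<And>i. i \<in> I \<Longrightarrow> p i \<in> P"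
  shows "(\<lambda>x. \<Sum>i\<in>I. c i * p i x) \<in> P"
proof -
  have "(\<Sum>i\<in>I. (\<lambda>x. c i * p i x)) \<in> P"
    using assms by (intro fun_space.subspace_sum fun_space.subspace_scale)
  also have "(\<Sum>i\<in>I. (\<lambda>x. c i * p i x)) = (\<lambda>x. \<Sum>i\<in>I. c i * p i x)"
    by (simp add: fun_eq_iff sum_fun_apply)
  finally show ?thesis .
qed

text \<open>An injective linear map between spaces of the same finite dimension is bijective. The
  target \<open>\<real>\<^sup>n\<close> appears as the sequences supported in \<open>{..<n}\<close>, so that \<open>n\<close> need not be
  the cardinality of a type; \<open>n > 0\<close> excludes an infinite-dimensional \<open>P\<close>, whose \<open>dim\<close> is \<open>0\<close>.\<close>

lemma dual_basis:
  fixes P :: "('a \<Rightarrow> real) set" and L :: "nat \<Rightarrow> ('a \<Rightarrow> real) \<Rightarrow> real"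
  assumes P: "fun_space.subspace P" and dim: "fun_space.dim P = n" "n > 0"
    and L: "\<And>i I c. i < n \<Longrightarrow> finite I \<Longrightarrow> I \<subseteq> P \<Longrightarrow>
      L i (\<lambda>x. \<Sum>g\<in>I. c g * g x) = (\<Sum>g\<in>I. c g * L i g)"
    and inj: "\<And>g. g \<in> P \<Longrightarrow> (\<And>i. i < n \<Longrightarrow> L i g = 0) \<Longrightarrow> g = (\<lambda>x. 0)"
  obtains p where "\<And>j. j < n \<Longrightarrow> p j \<in> P"
    "\<And>i j. i < n \<Longrightarrow> j < n \<Longrightarrow> L i (p j) = (if i = j then 1 else 0)"
proof -
  obtain B where B: "B \<subseteq> P" "fun_space.independent B" "P \<subseteq> fun_space.span B" "card B = n"
    using fun_space.basis_exists[of P] dim by metis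
  have finB: "finite B" using B(4) \<open>n > 0\<close> card_gt_0_iff by metis
  have comb_P: "(\<lambda>x. \<Sum>g\<in>B. c g * g x) \<in> P" for c
    using B(1) by (intro subspace_lincomb_closed[OF P finB]) auto
  define M where "M g = (\<lambda>i. if i < n then L i g else 0)" for g
  have M_sum: "(\<Sum>g\<in>B. c g * M g i) = M (\<lambda>x. \<Sum>g\<in>B. c g * g x) i" for c i
    using L[of i B c] finB B(1) by (simp add: M_def)
  \<comment> \<open>Coefficients of a relation among the images are coefficients of a relation in \<open>B\<close>.\<close>
  have rel: "c g = 0" if z: "\<And>i. (\<Sum>g\<in>B. c g * M g i) = 0" and "g \<in> B" for c g
  proof -
    have "(\<lambda>x. \<Sum>g\<in>B. c g * g x) = (\<lambda>x. 0)"
    proof (rule inj)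
      show "(\<lambda>x. \<Sum>g\<in>B. c g * g x) \<in> P"
        by (rule comb_P)
      show "L i (\<lambda>x. \<Sum>g\<in>B. c g * g x) = 0" if "i < n" for i
      proof -
        have "M (\<lambda>x. \<Sum>g\<in>B. c g * g x) i = 0" using M_sum[of c i] z[of i] by simp
        then show ?thesis using that by (simp add: M_def)
      qed
    qed
    then have "(\<Sum>g\<in>B. (\<lambda>x. c g * g x)) = 0"
      by (simp add: fun_eq_iff sum_fun_apply)
    then show ?thesis
      using fun_space.independentD[OF B(2) finB subset_refl] \<open>g \<in> B\<close> by blast
  qed
  have injM: "inj_on M B"
  proof (rule inj_onI, rule ccontr)
    fix g h assume gh: "g \<in> B" "h \<in> B" "M g = M h" "g \<noteq> h"
    \<comment> \<open>If two elements of \<open>B\<close> had the same image, their difference would give such a relation.\<close>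
    define c where "c k = (if k = g then 1 else 0) - (if k = h then (1::real) else 0)" for k
    have "(\<Sum>k\<in>B. c k * M k i) = M g i - M h i" for i
      using gh finB
      by (simp add: c_def left_diff_distrib sum_subtractf if_distrib[of "\<lambda>r. r * _"] cong: if_cong)
    then have "c g = 0" using rel[of c g] gh by simp
    then show False using gh by (simp add: c_def)
  qed
  have indM: "fun_space.independent (M ` B)"
  proof -
    have "c (M g) = 0" if "(\<Sum>w\<in>M ` B. (\<lambda>i. c w * w i)) = 0" "g \<in> B" for c g
    proof -
      have "(\<Sum>g\<in>B. c (M g) * M g i) = 0" for i
        using fun_cong[OF that(1), of i] by (simp add: sum.reindex[OF injM] sum_fun_apply)
      then show ?thesis using rel[of "\<lambda>g. c (M g)"] that(2) by blast
    qed
    then show ?thesis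
      using fun_space.dependent_finite[of "M ` B"] finB by auto
  qed
  define e where "e j = (\<lambda>i::nat. if i = j then 1 else (0::real))" for j
  have in_e: "w \<in> fun_space.span (e ` {..<n})" if "\<And>i. i \<ge> n \<Longrightarrow> w i = 0" for w
  proof -
    have "w = (\<lambda>i. \<Sum>j<n. w j * e j i)"
      using that by (auto simp: fun_eq_iff e_def if_distrib[of "\<lambda>r. _ * r"] cong: if_cong)
    moreover have "(\<lambda>i. \<Sum>j<n. w j * e j i) \<in> fun_space.span (e ` {..<n})"
      by (rule subspace_lincomb_closed) (auto intro: fun_space.span_base)
    ultimately show ?thesis by simp
  qed
  \<comment> \<open>Otherwise \<open>e j\<close> and the \<open>n\<close> images would be \<open>n + 1\<close> independent vectors in \<open>\<real>\<^sup>n\<close>.\<close>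
  have e_in: "e j \<in> fun_space.span (M ` B)" if "j < n" for j
  proof (rule ccontr)
    assume nin: "e j \<notin> fun_space.span (M ` B)"
    then have "fun_space.independent (insert (e j) (M ` B))"
      using indM by (simp add: fun_space.independent_insert)
    moreover have "insert (e j) (M ` B) \<subseteq> fun_space.span (e ` {..<n})"
    proof -
      have "e j \<in> fun_space.span (e ` {..<n})" using that by (intro fun_space.span_base) simp
      moreover have "M g \<in> fun_space.span (e ` {..<n})" for g by (rule in_e) (simp add: M_def)
      ultimately show ?thesis by blast
    qed
    ultimately have "card (insert (e j) (M ` B)) \<le> card (e ` {..<n})"
      by (intro fun_space.independent_span_bound[THEN conjunct2]) auto
    also have "\<dots> \<le> n" using card_image_le[of "{..<n}" e] by simp
    finally have "card (insert (e j) (M ` B)) \<le> n" .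
    moreover have "e j \<notin> M ` B"
      using nin by (rule contrapos_nn) (rule fun_space.span_base)
    ultimately show False using finB B(4) card_image[OF injM] by simp
  qed
  have "\<exists>g\<in>P. M g = e j" if j: "j < n" for j
  proof -
    obtain c where "e j = (\<Sum>w\<in>M ` B. (\<lambda>i. c w * w i))"
      using e_in[OF j] finB by (auto simp: fun_space.span_finite)
    then have "e j = M (\<lambda>x. \<Sum>g\<in>B. c (M g) * g x)"
      using M_sum[of "\<lambda>g. c (M g)"]
      by (simp add: fun_eq_iff sum.reindex[OF injM] sum_fun_apply)
    moreover have "(\<lambda>x. \<Sum>g\<in>B. c (M g) * g x) \<in> P"
      by (rule comb_P)
    ultimately show ?thesis by metis
  qed
  then obtain p where p: "\<And>j. j < n \<Longrightarrow> p j \<in> P \<and> M (p j) = e j" by metis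
  show ?thesis
  proof (rule that[of p])
    show "p j \<in> P" if "j < n" for j using p[OF that] by simp
    show "L i (p j) = (if i = j then 1 else 0)" if "i < n" "j < n" for i j
    proof -
      have "M (p j) i = e j i" using p[OF that(2)] by simp
      then show ?thesis using that by (simp add: M_def e_def)
    qed
  qed
qed

section \<open>Taylor bases of the one-dimensional spaces\<close>

lemma subspace_Pspace: "fun_space.subspace (Pspace n u v S)"
  unfolding Pspace_def by (rule fun_space.subspace_span)

lemma Pspace_zero_outside:
  assumes "g \<in> Pspace n u v S" "x \<notin> S"
  shows "g x = 0"
  using assms(1) unfolding Pspace_def
proof (induction rule: fun_space.span_induct_alt)
  case base
  then show ?case by simp
next
  case (step c g h)
  then show ?case using \<open>x \<notin> S\<close> by (auto simp: on_set_def)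
qed

lemma Pspace_n_times_diff:
  assumes "a < b" "Cn_on n {a..b} u" "Cn_on n {a..b} v" "g \<in> Pspace n u v {a..b}"
  shows "n_times_diff n {a..b} g"
  using assms(4) unfolding Pspace_def
proof (induction rule: fun_space.span_induct_alt)
  case base
  then show ?case using n_times_diff_zero[OF \<open>a < b\<close>] by (simp add: zero_fun_def)
next
  case (step c g h)
  then have "n_times_diff n {a..b} g"
    using assms(1) Cn_on_imp_n_times_diff[OF assms(2)] Cn_on_imp_n_times_diff[OF assms(3)]
    by (auto intro!: n_times_diff_on_set n_times_diff_power)
  then show ?case
    using n_times_diff_lincomb[OF \<open>a < b\<close>, of n g h c] step.IH
    by (simp add: plus_fun_def)
qed

text \<open>\<open>C2\<close> turns the vanishing of the two highest Taylor coefficients into a statement on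
  the whole interval, from which the remaining coefficients integrate back to \<open>g = 0\<close>.\<close>

lemma Taylor_determines:
  assumes "a < b" "n \<ge> 2" "Cn_on n {a..b} u" "Cn_on n {a..b} v" "C2 n u v a b"
    and s0: "s0 \<in> {a<..<b}" and g: "g \<in> Pspace n u v {a..b}"
    and zero: "\<And>i. i < n \<Longrightarrow> nth_deriv {a..b} i g s0 = 0"
  shows "g = (\<lambda>x. 0)"
proof
  fix x
  show "g x = 0"
  proof (cases "x \<in> {a..b}")
    case True
    have top: "\<forall>s\<in>{a..b}. nth_deriv {a..b} (n - 2) g s = 0"
    proof -
      have "nth_deriv {a..b} (n - 2) g s0 = 0" "nth_deriv {a..b} (n - 1) g s0 = 0"
        using zero \<open>n \<ge> 2\<close> by auto
      then show ?thesis using assms(5) g s0 unfolding C2_def by blast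
    qed
    have "n_times_diff (n - 2) {a..b} g"
      using Pspace_n_times_diff[OF assms(1,3,4) g] by (simp add: n_times_diff_def)
    moreover have "s0 \<in> {a..b}" using s0 by auto
    moreover have "nth_deriv {a..b} k g s0 = 0" if "k < n - 2" for k using zero that by auto
    ultimately show ?thesis using vanish_of_deriv_vanish top True by blast
  qed (use Pspace_zero_outside[OF g] in blast)
qed

lemma Taylor_basis:
  assumes ab: "a < b" and n: "n \<ge> 2" and uv: "Cn_on n {a..b} u" "Cn_on n {a..b} v"
    and dim: "fun_space.dim (Pspace n u v {a..b}) = n" and C2: "C2 n u v a b"
    and s0: "s0 \<in> {a<..<b}"
  obtains p where "\<And>j. j < n \<Longrightarrow> p j \<in> Pspace n u v {a..b}"
    "\<And>i c. i < n \<Longrightarrow> nth_deriv {a..b} i (\<lambda>x. \<Sum>j<n. c j * p j x) s0 = c i"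
    "\<And>g. g \<in> Pspace n u v {a..b} \<Longrightarrow> \<exists>c. g = (\<lambda>x. \<Sum>j<n. c j * p j x)"
proof -
  let ?P = "Pspace n u v {a..b}" and ?L = "\<lambda>i g. nth_deriv {a..b} i g s0"
  note diff = Pspace_n_times_diff[OF ab uv]
  have s0': "s0 \<in> {a..b}" using s0 by auto
  obtain p where pP: "\<And>j. j < n \<Longrightarrow> p j \<in> ?P"
    and Lp: "\<And>i j. i < n \<Longrightarrow> j < n \<Longrightarrow> ?L i (p j) = (if i = j then 1 else 0)"
  proof (rule dual_basis[OF subspace_Pspace dim, of ?L])
    show "?L i (\<lambda>x. \<Sum>g\<in>I. c g * g x) = (\<Sum>g\<in>I. c g * ?L i g)"
      if "i < n" "finite I" "I \<subseteq> ?P" for i I c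
      using nth_deriv_sum[OF ab \<open>finite I\<close>, of n "\<lambda>g. g" i s0 c] diff that s0' by auto
    show "g = (\<lambda>x. 0)" if "g \<in> ?P" "\<And>i. i < n \<Longrightarrow> ?L i g = 0" for g
      using Taylor_determines[OF ab n uv C2 s0 that] by blast
  qed (use n in auto)
  have L_sum: "?L i (\<lambda>x. \<Sum>j<n. c j * p j x) = c i" if "i < n" for i c
  proof -
    have "?L i (\<lambda>x. \<Sum>j<n. c j * p j x) = (\<Sum>j<n. c j * ?L i (p j))"
      using that s0' diff pP by (intro nth_deriv_sum[OF ab, where n = n]) auto
    also have "\<dots> = (\<Sum>j<n. if j = i then c j else 0)"
      by (rule sum.cong) (use Lp that in auto)
    also have "\<dots> = c i" using that by simp
    finally show ?thesis .
  qed
  have "g = (\<lambda>x. \<Sum>j<n. ?L j g * p j x)" if g: "g \<in> ?P" for g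
  proof -
    let ?h = "\<lambda>x. \<Sum>j<n. ?L j g * p j x"
    have h: "?h \<in> ?P" using pP by (intro subspace_lincomb_closed[OF subspace_Pspace]) auto
    have eq: "(\<lambda>x. (-1) * ?h x + g x) = g - ?h" by (simp add: fun_eq_iff)
    have "g - ?h = (\<lambda>x. 0)"
    proof (rule Taylor_determines[OF ab n uv C2 s0])
      show "g - ?h \<in> ?P" using fun_space.subspace_diff[OF subspace_Pspace g h] .
      show "?L i (g - ?h) = 0" if "i < n" for i
        using nth_deriv_lincomb[OF ab diff[OF h] diff[OF g], of i s0 "-1"]
          L_sum[OF that, of "\<lambda>j. ?L j g"] that s0' unfolding eq by simp
    qed
    then show ?thesis by (simp add: fun_eq_iff)
  qed
  then have "\<exists>c. g = (\<lambda>x. \<Sum>j<n. c j * p j x)" if "g \<in> ?P" for g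
    using that by (intro exI[of _ "\<lambda>j. ?L j g"])
  then show ?thesis using pP L_sum by (intro that[of p])
qed

section \<open>The tensor product\<close>

lemma tensor_span_expand:
  assumes p: "\<And>g. g \<in> P1 \<Longrightarrow> \<exists>c. g = (\<lambda>x. \<Sum>i<n1. c i * p i x)"
    and q: "\<And>g. g \<in> P2 \<Longrightarrow> \<exists>c. g = (\<lambda>x. \<Sum>j<n2. c j * q j x)"
    and "Q \<in> tensor_span P1 P2"
  shows "\<exists>c. Q = (\<lambda>(s, t). \<Sum>i<n1. \<Sum>j<n2. c i j * (p i s * q j t))"
  using assms(3) unfolding tensor_span_def
proof (induction rule: fun_space.span_induct_alt)
  case base
  show ?case by (rule exI[of _ "\<lambda>i j. 0"]) (simp add: fun_eq_iff)
next
  case (step r g h)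
  then obtain g1 g2 where g: "g = (\<lambda>(s, t). g1 s * g2 t)" "g1 \<in> P1" "g2 \<in> P2" by blast
  obtain c1 where c1: "g1 = (\<lambda>x. \<Sum>i<n1. c1 i * p i x)" using p g(2) by blast
  obtain c2 where c2: "g2 = (\<lambda>x. \<Sum>j<n2. c2 j * q j x)" using q g(3) by blast
  obtain c where c: "h = (\<lambda>(s, t). \<Sum>i<n1. \<Sum>j<n2. c i j * (p i s * q j t))"
    using step.IH by blast
  have "g = (\<lambda>(s, t). \<Sum>i<n1. \<Sum>j<n2. (c1 i * c2 j) * (p i s * q j t))"
    by (auto simp: g(1) c1 c2 fun_eq_iff sum_product intro!: sum.cong)
  then show ?case
    by (intro exI[of _ "\<lambda>i j. r * (c1 i * c2 j) + c i j"])
       (simp add: c fun_eq_iff sum_distrib_left sum.distrib distrib_right mult.assoc)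
qed

text \<open>The inner \<open>t\<close>-derivative is known for every first argument, also outside \<open>S\<close>, since
  the first argument enters only through the coefficients; so the outer \<open>s\<close>-derivative is again
  taken of a combination of the \<open>p i\<close>.\<close>

lemma mixed_deriv_expand:
  assumes p: "\<And>i c. i < n1 \<Longrightarrow> nth_deriv S i (\<lambda>x. \<Sum>k<n1. c k * p k x) s0 = c i"
    and q: "\<And>j c. j < n2 \<Longrightarrow> nth_deriv T j (\<lambda>x. \<Sum>k<n2. c k * q k x) t0 = c j"
    and "i < n1" "j < n2"
  shows "mixed_deriv S T i j (\<lambda>(s, t). \<Sum>k<n1. \<Sum>l<n2. c k l * (p k s * q l t)) (s0, t0) = c i j"
proof -
  have "(\<lambda>\<tau>. \<Sum>k<n1. \<Sum>l<n2. c k l * (p k \<sigma> * q l \<tau>)) =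
      (\<lambda>\<tau>. \<Sum>l<n2. (\<Sum>k<n1. c k l * p k \<sigma>) * q l \<tau>)" for \<sigma>
    by (rule ext, subst sum.swap) (simp add: sum_distrib_right mult.assoc)
  then show ?thesis
    using p[OF \<open>i < n1\<close>, of "\<lambda>k. c k j"] q[OF \<open>j < n2\<close>] by (simp add: mixed_deriv_def)
qed

theorem mainTheorem2:
  fixes a b c d :: real and n1 n2 :: nat and u1 v1 u2 v2 :: "real \<Rightarrow> real"
    and f :: "real \<times> real \<Rightarrow> real" and s0 t0 :: real
  assumes "a < b" and "c < d"
    and "n1 \<ge> 2" and "n2 \<ge> 2"
    and "Cn_on n1 {a..b} u1" and "Cn_on n1 {a..b} v1"
    and "Cn_on n2 {c..d} u2" and "Cn_on n2 {c..d} v2"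
    and "fun_space.dim (Pspace n1 u1 v1 {a..b}) = n1"
    and "fun_space.dim (Pspace n2 u2 v2 {c..d}) = n2"
    and "C1 n1 u1 v1 a b" and "C2 n1 u1 v1 a b"
    and "C1 n2 u2 v2 c d" and "C2 n2 u2 v2 c d"
    and "Cn2_on n1 n2 {a..b} {c..d} f"
    and "s0 \<in> {a<..<b}" and "t0 \<in> {c<..<d}"
  shows "\<exists>!Q. Q \<in> tensor_span (Pspace n1 u1 v1 {a..b}) (Pspace n2 u2 v2 {c..d}) \<and>
    (\<forall>i\<le>n1 - 1. \<forall>j\<le>n2 - 1.
       mixed_deriv {a..b} {c..d} i j Q (s0, t0) = mixed_deriv {a..b} {c..d} i j f (s0, t0))"
proof -
  let ?P1 = "Pspace n1 u1 v1 {a..b}" and ?P2 = "Pspace n2 u2 v2 {c..d}"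
  let ?D = "\<lambda>i j Q. mixed_deriv {a..b} {c..d} i j Q (s0, t0)"
  obtain p where pP: "\<And>i. i < n1 \<Longrightarrow> p i \<in> ?P1"
    and p: "\<And>i C. i < n1 \<Longrightarrow> nth_deriv {a..b} i (\<lambda>x. \<Sum>k<n1. C k * p k x) s0 = C i"
    and p_span: "\<And>g. g \<in> ?P1 \<Longrightarrow> \<exists>C. g = (\<lambda>x. \<Sum>k<n1. C k * p k x)"
    using Taylor_basis[of a b n1 u1 v1 s0] assms by blast
  obtain q where qP: "\<And>j. j < n2 \<Longrightarrow> q j \<in> ?P2"
    and q: "\<And>j C. j < n2 \<Longrightarrow> nth_deriv {c..d} j (\<lambda>x. \<Sum>k<n2. C k * q k x) t0 = C j"
    and q_span: "\<And>g. g \<in> ?P2 \<Longrightarrow> \<exists>C. g = (\<lambda>x. \<Sum>k<n2. C k * q k x)"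
    using Taylor_basis[of c d n2 u2 v2 t0] assms by blast
  define E where "E C = (\<lambda>(s, t). \<Sum>k<n1. \<Sum>l<n2. C k l * (p k s * q l t))" for C
  have D_E: "?D i j (E C) = C i j" if "i < n1" "j < n2" for i j C
    unfolding E_def using p q that by (intro mixed_deriv_expand) auto
  have E_in: "E C \<in> tensor_span ?P1 ?P2" for C
  proof -
    have "(\<Sum>k<n1. \<Sum>l<n2. (\<lambda>x. C k l * (case x of (s, t) \<Rightarrow> p k s * q l t)))
        \<in> tensor_span ?P1 ?P2"
      unfolding tensor_span_def using pP qP
      by (intro fun_space.span_sum fun_space.span_scale fun_space.span_base) blast
    also have "(\<Sum>k<n1. \<Sum>l<n2. (\<lambda>x. C k l * (case x of (s, t) \<Rightarrow> p k s * q l t))) = E C"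
      by (auto simp: E_def fun_eq_iff sum_fun_apply)
    finally show ?thesis .
  qed
  have le_iff: "i \<le> n1 - 1 \<longleftrightarrow> i < n1" "j \<le> n2 - 1 \<longleftrightarrow> j < n2" for i j
    using assms(3,4) by auto
  show ?thesis
    unfolding le_iff
  proof (rule ex1I[of _ "E (\<lambda>i j. ?D i j f)"])
    fix Q
    assume Q: "Q \<in> tensor_span ?P1 ?P2 \<and> (\<forall>i<n1. \<forall>j<n2. ?D i j Q = ?D i j f)"
    obtain C where C: "Q = E C"
      using tensor_span_expand[OF p_span q_span conjunct1[OF Q]] unfolding E_def by blast
    then have "C i j = ?D i j f" if "i < n1" "j < n2" for i j
      using D_E[OF that, of C] Q that by simp
    then show "Q = E (\<lambda>i j. ?D i j f)"
      unfolding C by (simp add: E_def fun_eq_iff)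
  qed (use E_in D_E in blast)
qed

end
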